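(* Let $G$ be a locally compact Hausdorff topological group. The following statements are equivalent: (1) $G$ is locally dense-separable; (2) $G$ is locally hereditarily separable; (3) $G$ is metrizable.
   Context: A space is dense-separable if each of its dense subspaces is separable, and hereditarily separable if each of its subspaces is separable. A space $X$ is locally dense-separable (resp., locally hereditarily separable) if, for each point $x\in X$, there is an open neighborhood $U$ of $x$ in $X$ such that the subspace $U$ is dense-separable (resp., hereditarily separable). *)

theory Defs
  imports "HOL-Analysis.Analysis"
begin

definition dense_separable_space :: "'a topology \<Rightarrow> bool" where
  "dense_separable_space X \<longleftrightarrow>
     (\<forall>D. D \<subseteq> topspace X \<and> X closure_of D = topspace X \<longrightarrow> separable_space (subtopology X D))"

definition hereditarily_separable_space :: "'a topology \<Rightarrow> bool" where
  "hereditarily_separable_space X \<longleftrightarrow>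
     (\<forall>S. S \<subseteq> topspace X \<longrightarrow> separable_space (subtopology X S))"

definition locally_dense_separable_space :: "'a topology \<Rightarrow> bool" where
  "locally_dense_separable_space X \<longleftrightarrow>
     (\<forall>x\<in>topspace X. \<exists>U. openin X U \<and> x \<in> U \<and> dense_separable_space (subtopology X U))"

definition locally_hereditarily_separable_space :: "'a topology \<Rightarrow> bool" where
  "locally_hereditarily_separable_space X \<longleftrightarrow>
     (\<forall>x\<in>topspace X. \<exists>U. openin X U \<and> x \<in> U \<and> hereditarily_separable_space (subtopology X U))"

text \<open>
  A Hausdorff topological group is a type of sort
  \<open>{topological_group_add, t2_space}\<close>. The group operation is written additively, but it is not
  assumed commutative: \<open>group_add\<close> is the class of arbitrary groups. The topology of the
  group as an abstract topology is \<open>euclidean\<close>, which is by definition \<open>topology open\<close>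
  for the open sets of the type; nothing Euclidean is assumed.
\<close>

end

theory Submission
  imports Defs "HOL-Library.Countable_Set_Type"
begin

text \<open>
  The substance is that a locally compact Hausdorff group that is not metrizable has, inside every
  open neighbourhood of the identity, a dense subset that is not separable. The model is the
  Cantor cube with coordinates indexed by the countable ordinals, where the points with at most
  countably many coordinates equal to \<open>1\<close> form such a set. The substitute for the coordinate
  condition \<open>x\<^sub>a = 1\<close> is membership in an open neighbourhood \<open>V a\<close> of \<open>0\<close>, for each countable ordinal \<open>a\<close>.

  Say that a subgroup is a \<^emph>\<open>G-delta subgroup\<close> if it is the intersection of countably many closed
  neighbourhoods of \<open>0\<close>, and fix a compact one, \<open>K\<close>, inside which the construction takes
  place. By the theorem of Birkhoff and Kakutani
  (\<open>Birkhoff_Kakutani\<close>), \<open>0\<close> has no countable neighbourhood base. In the presence of a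
  compact neighbourhood of \<open>0\<close> this prevents every G-delta subgroup from being trivial
  (\<open>gdelta_subgroup_nontrivial\<close>). Recursion over the countable ordinals therefore never gets stuck
  (\<open>escaping_nbhds\<close>): it yields open neighbourhoods \<open>V a\<close> of \<open>0\<close> and G-delta subgroups \<open>M a\<close>
  with \<open>V a + M a = V a\<close>, such that no left coset of \<open>N a = K \<inter> (\<Inter>b<a. M b)\<close> lies in \<open>V a\<close>.

  Let \<open>D\<close> be the set of the points that lie in no \<open>V b\<close> from some index on. It is dense
  (\<open>dense_eventually_outside\<close>): leaving finitely many sets \<open>V b\<close>, in increasing order of \<open>b\<close>,
  each time by a translation with an element of \<open>N b\<close>, does not undo earlier exits, since \<open>N b\<close>
  is contained in \<open>M c\<close> for \<open>c < b\<close> and the complement of \<open>V c\<close> is invariant under \<open>M c\<close>; compactness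
  takes care of all indices at once. On the other hand, a countable subset of \<open>D\<close> misses \<open>V a\<close>
  for all large \<open>a\<close>, because countable sets of countable ordinals are bounded; hence it is not
  dense in any neighbourhood of \<open>0\<close>.

  The converse direction is soft: in a metrizable space compact sets are totally bounded, total
  boundedness is inherited by subsets, and totally bounded sets are separable.
\<close>

section \<open>The countable ordinals\<close>

text \<open>
  The first uncountable ordinal, obtained as the cardinal successor of \<open>natLeq\<close>. It is made a type of
  class \<open>wellorder\<close> so that well-founded recursion and induction on finite linearly ordered sets
  apply to its elements directly.
\<close>

typedef omega1 = "Field (cardSuc natLeq)"
  using Field_cardSuc_not_empty[OF natLeq_Card_order] by blast

instantiation omega1 :: wellorder
begin

definition less_eq_omega1_def:
  "x \<le> y \<longleftrightarrow> (Rep_omega1 x, Rep_omega1 y) \<in> cardSuc natLeq"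

definition less_omega1_def:
  "(x::omega1) < y \<longleftrightarrow> x \<le> y \<and> x \<noteq> y"

instance
proof
  have wo: "Well_order (cardSuc natLeq)"
    by (rule cardSuc_Well_order[OF natLeq_Card_order])
  then have refl: "Refl (cardSuc natLeq)" and trans: "trans (cardSuc natLeq)"
    and antisym: "antisym (cardSuc natLeq)" and total: "Total (cardSuc natLeq)"
    and wf: "wf (cardSuc natLeq - Id)"
    by (auto simp: order_on_defs)
  show le_refl: "x \<le> x" for x :: omega1
    using refl Rep_omega1 by (auto simp: less_eq_omega1_def refl_on_def)
  show "x \<le> z" if "x \<le> y" "y \<le> z" for x y z :: omega1
    using trans that by (auto simp: less_eq_omega1_def dest: transD)
  show anti: "x = y" if "x \<le> y" "y \<le> x" for x y :: omega1
    using antisym that by (auto simp: less_eq_omega1_def Rep_omega1_inject dest: antisymD)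
  show "x < y \<longleftrightarrow> x \<le> y \<and> \<not> y \<le> x" for x y :: omega1
    using anti le_refl by (auto simp: less_omega1_def)
  show "x \<le> y \<or> y \<le> x" for x y :: omega1
    using total Rep_omega1 le_refl
    by (metis (full_types) less_eq_omega1_def total_on_def)
  show "P a" if "\<And>x. (\<And>y. y < x \<Longrightarrow> P y) \<Longrightarrow> P x" for P and a :: omega1
  proof -
    have "wf (inv_image (cardSuc natLeq - Id) Rep_omega1)"
      using wf by (rule wf_inv_image)
    then show ?thesis
      by (induction a) (rule that, auto simp: less_omega1_def less_eq_omega1_def Rep_omega1_inject)
  qed
qed

end

lemma countable_initial_segment_omega1: "countable {..<a::omega1}"
proof -
  include cardinal_syntax
  have "|underS (cardSuc natLeq) (Rep_omega1 a)| <o cardSuc natLeq"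
    by (rule card_of_underS[OF cardSuc_Card_order[OF natLeq_Card_order] Rep_omega1])
  then have "countable (underS (cardSuc natLeq) (Rep_omega1 a))"
    by (simp add: countable_card_le_natLeq cardSuc_ordLeq_ordLess natLeq_Card_order card_of_Card_order)
  moreover have "Rep_omega1 ` {..<a} \<subseteq> underS (cardSuc natLeq) (Rep_omega1 a)"
    by (auto simp: underS_def less_omega1_def less_eq_omega1_def Rep_omega1_inject)
  ultimately have "countable (Rep_omega1 ` {..<a})"
    by (rule countable_subset[rotated])
  then show ?thesis
    by (rule countable_image_inj_on) (auto simp: inj_on_def Rep_omega1_inject)
qed

lemma uncountable_omega1: "uncountable (UNIV :: omega1 set)"
proof
  include cardinal_syntax
  assume "countable (UNIV :: omega1 set)"
  then have "countable (range Rep_omega1)" by (rule countable_image)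
  then have "|Field (cardSuc natLeq)| \<le>o natLeq"
    by (simp add: type_definition.Rep_range[OF type_definition_omega1] countable_card_le_natLeq)
  moreover have "|Field (cardSuc natLeq)| =o cardSuc natLeq"
    by (rule card_of_Field_ordIso[OF cardSuc_Card_order[OF natLeq_Card_order]])
  ultimately have "cardSuc natLeq \<le>o natLeq"
    using ordIso_ordLeq_trans ordIso_symmetric by blast
  then show False
    using cardSuc_greater[OF natLeq_Card_order] not_ordLess_ordLeq by blast
qed

lemma countable_bounded_omega1:
  assumes "countable E"
  shows "\<exists>b::omega1. \<forall>a\<in>E. a < b"
proof (rule ccontr)
  assume "\<nexists>b. \<forall>a\<in>E. a < b"
  then have "(UNIV :: omega1 set) \<subseteq> (\<Union>a\<in>E. insert a {..<a})"
    by (force simp: not_less order.order_iff_strict)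
  moreover have "countable (\<Union>a\<in>E. insert a {..<a})"
    using assms by (intro countable_UN countable_insert countable_initial_segment_omega1)
  ultimately show False
    using uncountable_omega1 countable_subset by blast
qed

section \<open>Neighbourhoods of the identity\<close>

lemma open_left_translate:
  fixes U :: "'a::topological_group_add set"
  assumes "open U"
  shows "open {y. a + y \<in> U}"
  using open_vimage[OF assms, of "\<lambda>y. a + y"]
  by (simp add: vimage_def continuous_on_add continuous_on_const continuous_on_id)

lemma open_right_diff:
  fixes U :: "'a::topological_group_add set"
  assumes "open U"
  shows "open {y. y - a \<in> U}"
  using open_vimage[OF assms, of "\<lambda>y. y - a"]
  by (simp add: vimage_def continuous_on_diff continuous_on_const continuous_on_id)

lemma zero_nbhd_add:
  fixes W :: "'a::topological_group_add set"
  assumes "open W" "0 \<in> W"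
  obtains V where "open V" "0 \<in> V" "\<And>x y. x \<in> V \<Longrightarrow> y \<in> V \<Longrightarrow> x + y \<in> W"
proof -
  have "continuous_on UNIV (\<lambda>p::'a \<times> 'a. fst p + snd p)"
    by (intro continuous_intros)
  then have "open ((\<lambda>p::'a \<times> 'a. fst p + snd p) -` W)"
    using assms(1) by (rule open_vimage[rotated])
  moreover have "(0, 0) \<in> (\<lambda>p::'a \<times> 'a. fst p + snd p) -` W"
    using assms(2) by simp
  ultimately obtain A B where "open A" "open B" "(0, 0) \<in> A \<times> B"
    and "A \<times> B \<subseteq> (\<lambda>p::'a \<times> 'a. fst p + snd p) -` W"
    by (rule open_prod_elim)
  then show thesis
    by (intro that[of "A \<inter> B"]) auto
qed

lemma zero_nbhd_add3:
  fixes W :: "'a::topological_group_add set"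
  assumes "open W" "0 \<in> W"
  obtains V where "open V" "0 \<in> V" "\<And>x. x \<in> V \<Longrightarrow> - x \<in> V"
    "\<And>x y z. x \<in> V \<Longrightarrow> y \<in> V \<Longrightarrow> z \<in> V \<Longrightarrow> x + y + z \<in> W"
proof -
  obtain A where A: "open A" "0 \<in> A" "\<And>x y. x \<in> A \<Longrightarrow> y \<in> A \<Longrightarrow> x + y \<in> W"
    by (rule zero_nbhd_add[OF assms]) (rule that)
  obtain B where B: "open B" "0 \<in> B" "\<And>x y. x \<in> B \<Longrightarrow> y \<in> B \<Longrightarrow> x + y \<in> A"
    by (rule zero_nbhd_add[OF A(1,2)]) (rule that)
  have "continuous_on UNIV (\<lambda>x::'a. - x)"
    by (intro continuous_intros)
  then have "open (uminus -` (A \<inter> B))"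
    using A(1) B(1) by (intro open_vimage open_Int)
  then have op: "open (A \<inter> B \<inter> uminus -` (A \<inter> B))"
    using A(1) B(1) by (intro open_Int)
  show thesis
    using A(2,3) B(2,3) by (intro that[of "A \<inter> B \<inter> uminus -` (A \<inter> B)"] op) auto
qed

text \<open>
  The sum of three elements, rather than two, is what the chain estimate for the
  Birkhoff-Kakutani metric consumes.
\<close>

lemma nbhd_chain:
  fixes B :: "nat \<Rightarrow> 'a::topological_group_add set"
  assumes "\<And>n. open (B n)" "\<And>n. 0 \<in> B n"
  obtains S where "\<And>n. open (S n)" "\<And>n. 0 \<in> S n" "\<And>n x. x \<in> S n \<Longrightarrow> - x \<in> S n"
    "\<And>n x y z. x \<in> S (Suc n) \<Longrightarrow> y \<in> S (Suc n) \<Longrightarrow> z \<in> S (Suc n) \<Longrightarrow> x + y + z \<in> S n"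
    "\<And>n. S n \<subseteq> B n" "decseq S"
proof -
  define P where "P n V \<longleftrightarrow> open V \<and> 0 \<in> V \<and> (\<forall>x\<in>V. - x \<in> V) \<and> V \<subseteq> B n" for n V
  have 1: "\<exists>V. P 0 V"
  proof -
    obtain V where "open V" "0 \<in> V" "\<And>x. x \<in> V \<Longrightarrow> - x \<in> V"
      and sum: "\<And>x y z. x \<in> V \<Longrightarrow> y \<in> V \<Longrightarrow> z \<in> V \<Longrightarrow> x + y + z \<in> B 0"
      by (rule zero_nbhd_add3[OF assms]) (rule that)
    moreover have "V \<subseteq> B 0"
    proof
      fix x assume "x \<in> V"
      then have "0 + 0 + x \<in> B 0" using \<open>0 \<in> V\<close> by (intro sum)
      then show "x \<in> B 0" by simp
    qed
    ultimately show ?thesis by (auto simp: P_def)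
  qed
  have 2: "\<exists>V'. P (Suc n) V' \<and> (\<forall>x\<in>V'. \<forall>y\<in>V'. \<forall>z\<in>V'. x + y + z \<in> V)" if "P n V" for n V
  proof -
    have "open (V \<inter> B (Suc n))" "0 \<in> V \<inter> B (Suc n)"
      using that assms by (auto simp: P_def)
    then obtain V' where "open V'" "0 \<in> V'" "\<And>x. x \<in> V' \<Longrightarrow> - x \<in> V'"
      and sum: "\<And>x y z. x \<in> V' \<Longrightarrow> y \<in> V' \<Longrightarrow> z \<in> V' \<Longrightarrow> x + y + z \<in> V \<inter> B (Suc n)"
      by (rule zero_nbhd_add3) (rule that)
    moreover have "V' \<subseteq> V \<inter> B (Suc n)"
    proof
      fix x assume "x \<in> V'"
      then have "0 + 0 + x \<in> V \<inter> B (Suc n)" using \<open>0 \<in> V'\<close> by (intro sum)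
      then show "x \<in> V \<inter> B (Suc n)" by simp
    qed
    ultimately show ?thesis by (intro exI[of _ V']) (auto simp: P_def)
  qed
  have "\<exists>S. \<forall>n. P n (S n) \<and>
      (\<forall>x\<in>S (Suc n). \<forall>y\<in>S (Suc n). \<forall>z\<in>S (Suc n). x + y + z \<in> S n)"
    using 1 2 by (rule dependent_nat_choice)
  then obtain S where S: "\<And>n. P n (S n)"
    "\<And>n. \<forall>x\<in>S (Suc n). \<forall>y\<in>S (Suc n). \<forall>z\<in>S (Suc n). x + y + z \<in> S n"
    by blast
  have "S (Suc n) \<subseteq> S n" for n
  proof
    fix x assume "x \<in> S (Suc n)"
    moreover have "0 \<in> S (Suc n)" using S(1) by (simp add: P_def)
    ultimately have "0 + 0 + x \<in> S n" using S(2) by blast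
    then show "x \<in> S n" by simp
  qed
  then have "decseq S" by (rule decseq_SucI)
  then show thesis
    using S by (intro that[of S]) (auto simp: P_def)
qed

section \<open>The theorem of Birkhoff and Kakutani\<close>

text \<open>
  A finite list of weights can be cut at any level \<open>c\<close> at the cost of one separate entry: the entry
  at which the partial sums pass \<open>c\<close>. With \<open>c\<close> half the total, both remaining parts have at most
  half the weight, which drives the induction in the chain estimate.
\<close>

lemma split_list_at_weight:
  fixes f :: "'a \<Rightarrow> real"
  assumes "xs \<noteq> []" "0 \<le> c" "c \<le> sum_list (map f xs)" "\<And>x. 0 \<le> f x"
  shows "\<exists>ys z zs. xs = ys @ z # zs \<and> sum_list (map f ys) \<le> c
           \<and> sum_list (map f zs) \<le> sum_list (map f xs) - c"
  using assms(1-3)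
proof (induction xs arbitrary: c)
  case (Cons x xs)
  show ?case
  proof (cases "c \<le> f x")
    case True
    then show ?thesis
      using Cons.prems by (intro exI[of _ "[]"] exI[of _ x] exI[of _ xs]) auto
  next
    case False
    then have "xs \<noteq> []" "0 \<le> c - f x" "c - f x \<le> sum_list (map f xs)"
      using Cons.prems by auto
    from Cons.IH[OF this] obtain ys z zs where "xs = ys @ z # zs"
      "sum_list (map f ys) \<le> c - f x" "sum_list (map f zs) \<le> sum_list (map f xs) - (c - f x)"
      by blast
    then show ?thesis
      by (intro exI[of _ "x # ys"] exI[of _ z] exI[of _ zs]) auto
  qed
qed simp

lemma uminus_sum_list:
  "- sum_list xs = sum_list (rev (map uminus xs) :: 'a::group_add list)"
  by (induction xs) (auto simp: minus_add)

text \<open>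
  Take symmetric neighbourhoods \<open>S n\<close> forming a base at \<open>0\<close>, with three-fold sums of
  \<open>S (n + 1)\<close> inside \<open>S n\<close>. The gauge \<open>\<phi>\<close> takes the value \<open>(1/2) ^ (n + 1)\<close> on the difference
  of \<open>S n\<close> and \<open>S (n + 1)\<close>. It need not satisfy the triangle inequality, so it is replaced by the largest
  subadditive function \<open>N\<close> below it: the infimum of the total gauge over all ways to write a point as
  a finite sum. The chain estimate shows that \<open>N\<close> is still controlled from below by the sets \<open>S n\<close>, and
  \<open>N (- x + y)\<close> is the required left-invariant metric.
\<close>

theorem Birkhoff_Kakutani:
  fixes \<B> :: "'a::{topological_group_add, t2_space} set set"
  assumes "countable \<B>" "\<And>B. B \<in> \<B> \<Longrightarrow> open B \<and> 0 \<in> B"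
    and "\<And>W. open W \<Longrightarrow> 0 \<in> W \<Longrightarrow> \<exists>B\<in>\<B>. B \<subseteq> W"
  shows "metrizable_space (euclidean :: 'a topology)"
proof -
  have "\<B> \<noteq> {}" using assms(3)[of UNIV] by auto
  then have "\<And>n. open (from_nat_into \<B> n)" "\<And>n. 0 \<in> from_nat_into \<B> n"
    using assms(2)[OF from_nat_into] by auto
  then obtain S where op: "\<And>n. open (S n)" and zero_mem: "\<And>n. 0 \<in> S n"
    and sym: "\<And>n x. x \<in> S n \<Longrightarrow> - x \<in> S n"
    and sum: "\<And>n x y z. x \<in> S (Suc n) \<Longrightarrow> y \<in> S (Suc n) \<Longrightarrow> z \<in> S (Suc n) \<Longrightarrow> x + y + z \<in> S n"
    and sub: "\<And>n. S n \<subseteq> from_nat_into \<B> n" and dec: "decseq S"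
    by (rule nbhd_chain[of "from_nat_into \<B>"]) (rule that)
  have base: "\<exists>n. S n \<subseteq> W" if "open W" "0 \<in> W" for W
    using assms(3)[OF that] sub from_nat_into_surj[OF assms(1)] by blast
  define \<phi> :: "'a \<Rightarrow> real" where
    "\<phi> x = Inf (insert 1 {(1/2) ^ Suc n | n. x \<in> S n})" for x
  have bdd: "bdd_below (insert 1 {(1/2::real) ^ Suc n | n. x \<in> S n})" for x
    by (rule bdd_belowI[of _ 0]) (auto simp del: power_Suc)
  have \<phi>_nonneg: "0 \<le> \<phi> x" for x
    unfolding \<phi>_def by (rule cInf_greatest) (auto simp del: power_Suc)
  have \<phi>_le: "\<phi> x \<le> (1/2) ^ Suc n" if "x \<in> S n" for x n
    unfolding \<phi>_def using that by (intro cInf_lower bdd) blast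
  have \<phi>_less: "x \<in> S n" if less: "\<phi> x < (1/2) ^ n" for x n
  proof -
    obtain t where t: "t \<in> insert 1 {(1/2::real) ^ Suc n | n. x \<in> S n}" "t < (1/2) ^ n"
      using less unfolding \<phi>_def by (subst (asm) cInf_less_iff) (use bdd in auto)
    have "(1/2::real) ^ n \<le> 1" by (simp add: power_le_one)
    then obtain m where m: "x \<in> S m" "(1/2::real) ^ Suc m < (1/2) ^ n" using t by auto
    then have "n < Suc m" by (subst (asm) power_strict_decreasing_iff) auto
    then show ?thesis using m(1) dec by (auto simp: decseq_def less_Suc_eq_le)
  qed
  have \<phi>_uminus: "\<phi> (- x) = \<phi> x" for x
    unfolding \<phi>_def using sym by (metis minus_minus)
  \<comment> \<open>Cut the list at half its weight; the two parts, by induction, and the single entry between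
    them lie in \<open>S (n + 1)\<close>.\<close>
  have chain: "sum_list xs \<in> S n" if "sum_list (map \<phi> xs) < (1/2) ^ Suc n" for xs n
    using that
  proof (induction xs arbitrary: n rule: length_induct)
    case (1 xs)
    show ?case
    proof (cases "xs = []")
      case False
      let ?s = "sum_list (map \<phi> xs)"
      have s: "0 \<le> ?s" using \<phi>_nonneg by (auto intro!: sum_list_nonneg)
      then have "\<exists>ys z zs. xs = ys @ z # zs \<and> sum_list (map \<phi> ys) \<le> ?s / 2 \<and>
          sum_list (map \<phi> zs) \<le> ?s - ?s / 2"
        using \<phi>_nonneg by (intro split_list_at_weight False) auto
      then obtain ys z zs where xs: "xs = ys @ z # zs"
        and ys: "sum_list (map \<phi> ys) \<le> ?s / 2" and zs: "sum_list (map \<phi> zs) \<le> ?s - ?s / 2"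
        by blast
      have half: "?s / 2 < (1/2) ^ Suc (Suc n)" using "1.prems" by simp
      have IH: "sum_list us \<in> S (Suc n)"
        if "length us < length xs" "sum_list (map \<phi> us) \<le> ?s / 2" for us
        using "1.IH" that half by (meson le_less_trans)
      have "sum_list ys \<in> S (Suc n)" using ys by (intro IH) (simp_all add: xs)
      moreover have "sum_list (map \<phi> zs) \<le> ?s / 2" using zs by linarith
      then have "sum_list zs \<in> S (Suc n)" by (intro IH) (simp_all add: xs)
      moreover have "0 \<le> sum_list (map \<phi> ys)" "0 \<le> sum_list (map \<phi> zs)"
        using \<phi>_nonneg by (auto intro!: sum_list_nonneg)
      then have "\<phi> z < (1/2) ^ Suc n" using "1.prems" xs by simp
      then have "z \<in> S (Suc n)" by (rule \<phi>_less)
      ultimately show ?thesis using sum xs by (auto simp: add.assoc)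
    qed (simp add: zero_mem)
  qed
  define L where "L x = {sum_list (map \<phi> xs) | xs. sum_list xs = x}" for x
  define N where "N x = Inf (L x)" for x
  have L_nonneg: "0 \<le> t" if "t \<in> L x" for t x
    using that \<phi>_nonneg by (auto simp: L_def intro!: sum_list_nonneg)
  have L_bdd: "bdd_below (L x)" for x
    using L_nonneg by (intro bdd_belowI[of _ 0])
  have \<phi>_L: "\<phi> x \<in> L x" for x
    unfolding L_def by (rule CollectI, rule exI[of _ "[x]"]) simp
  then have L_ne: "L x \<noteq> {}" for x by auto
  have N_nonneg: "0 \<le> N x" for x
    unfolding N_def using L_ne L_nonneg by (intro cInf_greatest)
  have N_le: "N x \<le> \<phi> x" for x
    unfolding N_def using \<phi>_L L_bdd by (intro cInf_lower)
  have N_less: "x \<in> S n" if "N x < (1/2) ^ Suc n" for x n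
    using that L_ne L_bdd chain unfolding N_def by (subst (asm) cInf_less_iff) (auto simp: L_def)
  have L_uminus: "L x \<subseteq> L (- x)" for x
  proof
    fix t assume "t \<in> L x"
    then obtain xs where "t = sum_list (map \<phi> xs)" "sum_list xs = x"
      by (auto simp: L_def)
    then have "t = sum_list (map \<phi> (rev (map uminus xs)))" "sum_list (rev (map uminus xs)) = - x"
      by (auto simp: uminus_sum_list rev_map[symmetric] comp_def \<phi>_uminus)
    then show "t \<in> L (- x)" unfolding L_def by blast
  qed
  have N_uminus: "N (- x) = N x" for x
    unfolding N_def using L_uminus[of x] L_uminus[of "- x"] by (simp add: antisym)
  have N_add: "N (x + y) \<le> N x + N y" for x y
  proof (rule field_le_epsilon)
    fix e :: real assume "0 < e"
    then have "Inf (L x) < N x + e / 2" "Inf (L y) < N y + e / 2" by (auto simp: N_def)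
    then obtain s t where st: "s \<in> L x" "s < N x + e / 2" "t \<in> L y" "t < N y + e / 2"
      using L_ne L_bdd by (meson cInf_less_iff)
    then obtain xs ys where "s = sum_list (map \<phi> xs)" "sum_list xs = x"
      "t = sum_list (map \<phi> ys)" "sum_list ys = y" by (auto simp: L_def)
    then have "s + t \<in> L (x + y)"
      unfolding L_def by (intro CollectI exI[of _ "xs @ ys"]) auto
    then have "N (x + y) \<le> s + t" unfolding N_def using L_bdd by (rule cInf_lower)
    then show "N (x + y) \<le> N x + N y + e" using st by linarith
  qed
  have small: "\<exists>n. (1/2::real) ^ Suc n < r" if r: "0 < r" for r
  proof -
    obtain n where n: "(1/2::real) ^ n < r" using real_arch_pow_inv[OF r, where x="1/2"] by auto
    have "(1/2::real) ^ Suc n < r" using n r by simp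
    then show ?thesis ..
  qed
  have N_zero: "N x = 0 \<longleftrightarrow> x = 0" for x
  proof
    assume "N x = 0"
    then have in_all: "x \<in> S n" for n by (intro N_less) simp
    show "x = 0"
    proof (rule ccontr)
      assume "x \<noteq> 0"
      then obtain W where "open W" "0 \<in> W" "x \<notin> W" using t1_space by metis
      then show False using base in_all by blast
    qed
  next
    assume "x = 0"
    have "sum_list (map \<phi> []) \<in> L 0" unfolding L_def by (intro CollectI exI[of _ "[]"]) auto
    then have "N 0 \<le> 0" unfolding N_def using L_bdd by (intro cInf_lower) auto
    with N_nonneg[of 0] \<open>x = 0\<close> show "N x = 0" by simp
  qed
  define d where "d x y = N (- x + y)" for x y
  interpret Metric_space UNIV d
  proof
    show "d x y = d y x" for x y
      unfolding d_def using N_uminus[of "- x + y"] by (simp add: minus_add)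
    show "d x z \<le> d x y + d y z" for x y z
      unfolding d_def using N_add[of "- x + y" "- y + z"] by (simp add: add.assoc)
    show "d x y = 0 \<longleftrightarrow> x = y" for x y
      unfolding d_def N_zero by (metis add.right_inverse add_0_right minus_unique minus_minus)
  qed (simp add: d_def N_nonneg)
  have "openin mtopology U \<longleftrightarrow> open U" for U
  proof
    assume "open U"
    have "\<exists>r>0. mball x r \<subseteq> U" if x: "x \<in> U" for x
    proof -
      obtain n where "S n \<subseteq> {y. x + y \<in> U}"
        using base[of "{y. x + y \<in> U}"] open_left_translate[OF \<open>open U\<close>] x by auto
      moreover have "mball x ((1/2) ^ Suc n) \<subseteq> {y. - x + y \<in> S n}"
        using N_less by (simp add: d_def subset_iff del: power_Suc)
      ultimately have "mball x ((1/2) ^ Suc n) \<subseteq> U"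
        by (force simp: add.assoc[symmetric])
      then show ?thesis by (intro exI[of _ "(1/2) ^ Suc n"]) auto
    qed
    then show "openin mtopology U" by (auto simp: openin_mtopology)
  next
    assume U: "openin mtopology U"
    show "open U"
    proof (subst open_subopen, intro ballI)
      fix x assume "x \<in> U"
      then obtain r where r: "r > 0" "mball x r \<subseteq> U" using U by (auto simp: openin_mtopology)
      then obtain n where n: "(1/2) ^ Suc n < r" using small by blast
      have "{y. - x + y \<in> S n} \<subseteq> mball x r"
        using order.strict_trans1[OF order.trans[OF N_le \<phi>_le] n] by (simp add: d_def subset_iff)
      then have "{y. - x + y \<in> S n} \<subseteq> U" using r(2) by (rule subset_trans)
      then show "\<exists>T. open T \<and> x \<in> T \<and> T \<subseteq> U"
        by (intro exI[of _ "{y. - x + y \<in> S n}"]) (auto simp: open_left_translate op zero_mem)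
    qed
  qed
  then have "mtopology = (euclidean :: 'a topology)"
    by (simp add: topology_eq)
  then show ?thesis using metrizable_space_mtopology by simp
qed

section \<open>G-delta subgroups\<close>

text \<open>
  Asking for closed neighbourhoods instead of open sets makes the subgroup closed, and makes
  compactness applicable to the family of neighbourhoods itself.
\<close>

definition gdelta_subgroup :: "'a::topological_group_add set \<Rightarrow> bool" where
  "gdelta_subgroup M \<longleftrightarrow>
     0 \<in> M \<and> (\<forall>x\<in>M. \<forall>y\<in>M. x + y \<in> M) \<and> (\<forall>x\<in>M. - x \<in> M) \<and>
     (\<exists>\<Q>. countable \<Q> \<and> (\<forall>Q\<in>\<Q>. closed Q \<and> 0 \<in> interior Q) \<and> M = \<Inter>\<Q>)"

lemma gdelta_subgroup_closed: "gdelta_subgroup M \<Longrightarrow> closed M"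
  by (auto simp: gdelta_subgroup_def)

lemma gdelta_subgroup_Inter:
  assumes "countable I" "\<And>i. i \<in> I \<Longrightarrow> gdelta_subgroup (M i)"
  shows "gdelta_subgroup (\<Inter>i\<in>I. M i)"
proof -
  have "\<forall>i\<in>I. \<exists>\<Q>. countable \<Q> \<and> (\<forall>Q\<in>\<Q>. closed Q \<and> 0 \<in> interior Q) \<and> M i = \<Inter>\<Q>"
    using assms(2) by (simp add: gdelta_subgroup_def)
  then obtain \<Q> where Q: "\<And>i. i \<in> I \<Longrightarrow> countable (\<Q> i)"
    "\<And>i Q. i \<in> I \<Longrightarrow> Q \<in> \<Q> i \<Longrightarrow> closed Q \<and> 0 \<in> interior Q" "\<And>i. i \<in> I \<Longrightarrow> M i = \<Inter>(\<Q> i)"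
    by metis
  show ?thesis
    unfolding gdelta_subgroup_def
  proof (intro conjI ballI exI)
    show "countable (\<Union>i\<in>I. \<Q> i)" using assms(1) Q(1) by blast
    show "(\<Inter>i\<in>I. M i) = \<Inter>(\<Union>i\<in>I. \<Q> i)" using Q(3) by auto
  qed (use assms(2) Q(2) in \<open>auto simp: gdelta_subgroup_def\<close>)
qed

lemma gdelta_subgroup_Int:
  assumes "gdelta_subgroup K" "gdelta_subgroup M"
  shows "gdelta_subgroup (K \<inter> M)"
  using gdelta_subgroup_Inter[of "{K, M}" "\<lambda>M. M"] assms by auto

text \<open>
  For a chain \<open>S n\<close> of neighbourhoods inside \<open>W\<close>, the intersection \<open>M\<close> of the chain is a G-delta
  subgroup and \<open>V = S 2 + M\<close> is a union of left cosets of \<open>M\<close> that is still so small that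
  differences of its elements lie in \<open>W\<close>.
\<close>

lemma ex_saturated_nbhd:
  fixes W :: "'a::topological_group_add set"
  assumes "open W" "0 \<in> W"
  obtains V M where "gdelta_subgroup M" "M \<subseteq> W" "open V" "0 \<in> V"
    "\<And>v m. v \<in> V \<Longrightarrow> m \<in> M \<Longrightarrow> v + m \<in> V" "\<And>a b. a \<in> V \<Longrightarrow> b \<in> V \<Longrightarrow> - a + b \<in> W"
proof -
  obtain S where op: "\<And>n::nat. open (S n)" and zero: "\<And>n. 0 \<in> S n"
    and sym: "\<And>n x. x \<in> S n \<Longrightarrow> - x \<in> S n"
    and sum: "\<And>n x y z. x \<in> S (Suc n) \<Longrightarrow> y \<in> S (Suc n) \<Longrightarrow> z \<in> S (Suc n) \<Longrightarrow> x + y + z \<in> S n"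
    and sub: "\<And>n. S n \<subseteq> W"
    by (rule nbhd_chain[of "\<lambda>_. W"]) (rule assms, rule assms, rule that)
  have sum2: "x + y \<in> S n" if "x \<in> S (Suc n)" "y \<in> S (Suc n)" for x y n
    using sum[OF that zero] by simp
  define M where "M = (\<Inter>n. S n)"
  have clos: "closure (S (Suc n)) \<subseteq> S n" for n
  proof
    fix x assume "x \<in> closure (S (Suc n))"
    moreover have "x \<in> {y. - x + y \<in> S (Suc n)}"
      using zero by simp
    ultimately obtain y where y: "y \<in> S (Suc n)" "- x + y \<in> S (Suc n)"
      using open_Int_closure_eq_empty[OF open_left_translate[OF op], of "- x" "Suc n" "S (Suc n)"]
      by blast
    have "y + - (- x + y) \<in> S n" by (rule sum2[OF y(1) sym[OF y(2)]])
    then show "x \<in> S n" by (simp add: minus_add add.assoc[symmetric])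
  qed
  have M_closed: "M = (\<Inter>n. closure (S n))"
  proof
    show "M \<subseteq> (\<Inter>n. closure (S n))"
      unfolding M_def by (intro INF_mono') (rule closure_subset)
    show "(\<Inter>n. closure (S n)) \<subseteq> M"
      unfolding M_def using clos by (intro INF_mono) blast
  qed
  have M_add: "x + y \<in> M" if "x \<in> M" "y \<in> M" for x y
    using that sum2 unfolding M_def by blast
  have "gdelta_subgroup M"
    unfolding gdelta_subgroup_def
  proof (intro conjI ballI exI)
    show "M = \<Inter>(range (\<lambda>n. closure (S n)))" by (fact M_closed)
    show "0 \<in> interior Q" if "Q \<in> range (\<lambda>n. closure (S n))" for Q
      using that interiorI[OF op zero closure_subset] by auto
  qed (use zero sym M_add in \<open>auto simp: M_def\<close>)
  moreover have "M \<subseteq> W" using sub by (auto simp: M_def)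
  moreover have "open (\<Union>m\<in>M. {v. v - m \<in> S 2})"
    using open_right_diff[OF op] by blast
  moreover have "0 \<in> (\<Union>m\<in>M. {v. v - m \<in> S 2})"
    using zero by (auto simp: M_def intro!: bexI[of _ 0])
  moreover have "v + m \<in> (\<Union>m\<in>M. {v. v - m \<in> S 2})"
    if "v \<in> (\<Union>m\<in>M. {v. v - m \<in> S 2})" "m \<in> M" for v m
  proof -
    obtain m' where "m' \<in> M" "v - m' \<in> S 2" using \<open>v \<in> _\<close> by auto
    moreover have "v + m - (m' + m) = v - m'"
      by (simp add: diff_conv_add_uminus minus_add add.assoc del: add_uminus_conv_diff)
    ultimately show ?thesis using M_add[OF \<open>m' \<in> M\<close> \<open>m \<in> M\<close>] by (metis UN_iff mem_Collect_eq)
  qed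
  moreover have "- a + b \<in> W"
    if ab: "a \<in> (\<Union>m\<in>M. {v. v - m \<in> S 2})" "b \<in> (\<Union>m\<in>M. {v. v - m \<in> S 2})" for a b
  proof -
    obtain m n where mn: "m \<in> M" "n \<in> M" "a - m \<in> S 2" "b - n \<in> S 2" using ab by auto
    have "- (a - m) \<in> S (Suc 1)" "b - n \<in> S (Suc 1)"
      using sym[OF mn(3)] mn(4) by (simp_all add: numeral_2_eq_2)
    then have "- (a - m) + (b - n) \<in> S 1" by (rule sum2)
    moreover have "- m \<in> S 1" "n \<in> S 1" using mn sym by (auto simp: M_def)
    ultimately have "- m + (- (a - m) + (b - n)) + n \<in> S 0" using sum[of _ 0] by simp
    moreover have "- m + (- (a - m) + (b - n)) + n = - a + b"
      by (simp add: diff_conv_add_uminus minus_add add.assoc del: add_uminus_conv_diff)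
    ultimately show ?thesis using sub by auto
  qed
  ultimately show thesis by (rule that)
qed

text \<open>
  If countably many closed neighbourhoods of \<open>0\<close> meet only in \<open>0\<close>, then, by compactness of \<open>C\<close>, the
  finite intersections of their interiors with that of \<open>C\<close> form a countable base at \<open>0\<close>, and the group
  is metrizable.
\<close>

lemma gdelta_subgroup_nontrivial:
  fixes C N :: "'a::{topological_group_add, t2_space} set"
  assumes "\<not> metrizable_space (euclidean :: 'a topology)"
    and "compact C" "0 \<in> interior C" "gdelta_subgroup N"
  shows "N \<noteq> {0}"
proof
  assume "N = {0}"
  obtain \<Q> where \<Q>: "countable \<Q>" "\<And>Q. Q \<in> \<Q> \<Longrightarrow> closed Q \<and> 0 \<in> interior Q" "N = \<Inter>\<Q>"
    using assms(4) unfolding gdelta_subgroup_def by blast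
  define \<B> where "\<B> = (\<lambda>F. interior C \<inter> (\<Inter>Q\<in>F. interior Q)) ` {F. finite F \<and> F \<subseteq> \<Q>}"
  have "countable \<B>"
    unfolding \<B>_def by (intro countable_image countable_Collect_finite_subset \<Q>)
  moreover have "open B \<and> 0 \<in> B" if "B \<in> \<B>" for B
    using that assms(3) \<Q>(2) by (auto simp: \<B>_def subset_iff intro!: open_Int open_INT)
  moreover have "\<exists>B\<in>\<B>. B \<subseteq> W" if W: "open W" "0 \<in> W" for W
  proof (rule ccontr)
    assume no: "\<not> (\<exists>B\<in>\<B>. B \<subseteq> W)"
    have "(C - W) \<inter> \<Inter>\<Q> \<noteq> {}"
    proof (rule compact_imp_fip)
      show "compact (C - W)" using assms(2) W(1) by (rule compact_diff)
      show "closed Q" if "Q \<in> \<Q>" for Q using \<Q>(2) that by blast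
      show "(C - W) \<inter> \<Inter>F \<noteq> {}" if "finite F" "F \<subseteq> \<Q>" for F
      proof -
        have "interior C \<inter> (\<Inter>Q\<in>F. interior Q) \<in> \<B>" using that by (auto simp: \<B>_def)
        then obtain x where "x \<in> interior C \<inter> (\<Inter>Q\<in>F. interior Q)" "x \<notin> W" using no by blast
        then have "x \<in> (C - W) \<inter> \<Inter>F" using interior_subset by blast
        then show ?thesis by blast
      qed
    qed
    then show False using W(2) \<Q>(3) \<open>N = {0}\<close> by auto
  qed
  ultimately show False using Birkhoff_Kakutani[of \<B>] assms(1) by blast
qed

section \<open>A dense set that is not separable\<close>

text \<open>
  At stage \<open>a\<close>, the G-delta subgroup \<open>N = K \<inter> (\<Inter>b<a. M b)\<close> contains some \<open>n \<noteq> 0\<close>, as only countably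
  many subgroups have been intersected. A neighbourhood \<open>V\<close> whose differences \<open>- x + y\<close> avoid \<open>n\<close>
  cannot contain a coset \<open>x + N\<close>, since it would contain both \<open>x\<close> and \<open>x + n\<close>.
\<close>

lemma escaping_nbhds:
  fixes C K :: "'a::{topological_group_add, t2_space} set"
  assumes "\<not> metrizable_space (euclidean :: 'a topology)"
    and "compact C" "0 \<in> interior C" and K: "gdelta_subgroup K"
  obtains V M :: "omega1 \<Rightarrow> 'a set" where
    "\<And>a. gdelta_subgroup (M a)" "\<And>a. open (V a)" "\<And>a. 0 \<in> V a"
    "\<And>a v m. v \<in> V a \<Longrightarrow> m \<in> M a \<Longrightarrow> v + m \<in> V a"
    "\<And>a x. \<exists>n \<in> K \<inter> (\<Inter>b\<in>{..<a}. M b). x + n \<notin> V a"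
proof -
  define P where "P f a r \<longleftrightarrow> gdelta_subgroup (snd r) \<and> open (fst r) \<and> 0 \<in> fst r \<and>
    (\<forall>v\<in>fst r. \<forall>m\<in>snd r. v + m \<in> fst r) \<and>
    (\<forall>x. \<exists>n \<in> K \<inter> (\<Inter>b\<in>{..<a}. snd (f b)). x + n \<notin> fst r)"
    for f :: "omega1 \<Rightarrow> 'a set \<times> 'a set" and a and r :: "'a set \<times> 'a set"
  have "\<exists>f. \<forall>a. P f a (f a)"
  proof (rule dependent_wf_choice)
    show "wf {(b, a :: omega1). b < a}" by (rule wf)
    show "P f a r = P g a r" if "\<And>b. (b, a) \<in> {(b, a). b < a} \<Longrightarrow> f b = g b" for f g a r
      using that by (simp add: P_def)
    show "\<exists>r. P f a r" if IH: "\<And>b. (b, a) \<in> {(b, a). b < a} \<Longrightarrow> P f b (f b)" for f a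
    proof -
      let ?N = "K \<inter> (\<Inter>b\<in>{..<a}. snd (f b))"
      have "gdelta_subgroup (\<Inter>b\<in>{..<a}. snd (f b))"
        using IH by (intro gdelta_subgroup_Inter countable_initial_segment_omega1) (simp add: P_def)
      with K have N: "gdelta_subgroup ?N" by (rule gdelta_subgroup_Int)
      then have "?N \<noteq> {0}" "0 \<in> ?N"
        using gdelta_subgroup_nontrivial[OF assms(1-3)] by (blast, simp add: gdelta_subgroup_def)
      then obtain n where n: "n \<in> ?N" "n \<noteq> 0" by blast
      then obtain W where W: "open W" "0 \<in> W" "n \<notin> W" using t1_space by metis
      obtain V M where VM: "gdelta_subgroup M" "M \<subseteq> W" "open V" "0 \<in> V"
        "\<And>v m. v \<in> V \<Longrightarrow> m \<in> M \<Longrightarrow> v + m \<in> V" "\<And>x y. x \<in> V \<Longrightarrow> y \<in> V \<Longrightarrow> - x + y \<in> W"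
        by (rule ex_saturated_nbhd[OF W(1,2)]) (rule that)
      have "\<exists>n\<in>?N. x + n \<notin> V" for x
      proof (rule ccontr)
        assume "\<not> (\<exists>n\<in>?N. x + n \<notin> V)"
        then have "x + 0 \<in> V" "x + n \<in> V" using n \<open>0 \<in> ?N\<close> by blast+
        then have "- (x + 0) + (x + n) \<in> W" by (rule VM(6))
        then show False using W(3) by simp
      qed
      then have "P f a (V, M)" using VM by (simp add: P_def)
      then show ?thesis ..
    qed
  qed
  then obtain f where f: "\<And>a. P f a (f a)" by blast
  show thesis
    by (rule that[of "\<lambda>a. snd (f a)" "\<lambda>a. fst (f a)"]) (use f in \<open>auto simp: P_def\<close>)
qed

text \<open>
  Given \<open>w\<close> in an open set \<open>T\<close>, one looks for a point outside all late \<open>V b\<close> in a coset \<open>w + N a\<close>. Such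
  a coset need not lie in \<open>T\<close>. But every \<open>V b\<close> is invariant under translation by elements of the
  intersection \<open>H\<close> of all \<open>N a\<close>, so a point of \<open>T + H\<close> outside \<open>V b\<close> can be moved back into \<open>T\<close> without
  entering \<open>V b\<close>. It is therefore enough that \<open>w + N a\<close> lies in \<open>T + H\<close>, and compactness provides
  such an \<open>a\<close>.
\<close>

lemma dense_eventually_outside:
  fixes V M :: "omega1 \<Rightarrow> 'a::{topological_group_add, t2_space} set"
  assumes "gdelta_subgroup K" "compact K" "\<And>a. gdelta_subgroup (M a)" "\<And>a. open (V a)"
    and sat: "\<And>a v m. v \<in> V a \<Longrightarrow> m \<in> M a \<Longrightarrow> v + m \<in> V a"
    and esc: "\<And>a x. \<exists>n \<in> K \<inter> (\<Inter>b\<in>{..<a}. M b). x + n \<notin> V a"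
    and T: "open T" "w \<in> T"
  obtains x a where "x \<in> T" "\<And>b. a \<le> b \<Longrightarrow> x \<notin> V b"
proof -
  define N where "N a = K \<inter> (\<Inter>b\<in>{..<a}. M b)" for a
  have M_group: "0 \<in> M a" "x \<in> M a \<Longrightarrow> y \<in> M a \<Longrightarrow> x + y \<in> M a" "x \<in> M a \<Longrightarrow> - x \<in> M a"
    for a x y using assms(3) by (auto simp: gdelta_subgroup_def)
  have N_add: "x + y \<in> N a" if "x \<in> N a" "y \<in> N a" for x y a
    using that assms(1) M_group by (auto simp: N_def gdelta_subgroup_def)
  have N_anti: "N b \<subseteq> N a" if "a \<le> b" for a b
    using that by (auto simp: N_def)
  define H where "H = K \<inter> (\<Inter>b. M b)"
  \<comment> \<open>The elements \<open>y\<close> with \<open>w + y\<close> in the saturation \<open>T + H\<close>.\<close>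
  define T' where "T' = (\<Union>h\<in>H. {y. (w + y) - h \<in> T})"
  have "{y. (w + y) - h \<in> T} = {y. w + y \<in> {z. z - h \<in> T}}" for h by simp
  then have "open {y. (w + y) - h \<in> T}" for h
    using open_left_translate[OF open_right_diff[OF T(1)]] by presburger
  then have "open T'" unfolding T'_def by blast
  have "\<exists>a. N a \<subseteq> T'"
  proof (rule ccontr)
    assume no: "\<nexists>a. N a \<subseteq> T'"
    have "(K - T') \<inter> (\<Inter>b\<in>UNIV. M b) \<noteq> {}"
    proof (rule compact_imp_fip_image)
      show "compact (K - T')" using assms(2) \<open>open T'\<close> by (rule compact_diff)
      show "closed (M b)" for b using assms(3) by (rule gdelta_subgroup_closed)
      fix F :: "omega1 set" assume "finite F"
      then obtain a where "\<forall>b\<in>F. b < a"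
        using countable_bounded_omega1[OF countable_finite] by blast
      moreover obtain n where "n \<in> N a" "n \<notin> T'" using no by blast
      ultimately show "(K - T') \<inter> (\<Inter>b\<in>F. M b) \<noteq> {}" by (auto simp: N_def)
    qed
    then obtain h where "h \<in> H" "h \<notin> T'" by (auto simp: H_def)
    moreover have "w + h - h \<in> T" using T(2) by simp
    ultimately show False by (auto simp: T'_def)
  qed
  then obtain a where a: "N a \<subseteq> T'" ..
  have finite_escape: "\<exists>n\<in>N a. \<forall>b\<in>F. w + n \<notin> V b" if "finite F" "F \<subseteq> {a..}" for F
    using that
  proof (induction F rule: finite_linorder_max_induct)
    case empty
    then show ?case using assms(1) M_group by (auto simp: N_def gdelta_subgroup_def)
  next
    case (insert c F)
    then obtain n where n: "n \<in> N a" "\<And>b. b \<in> F \<Longrightarrow> w + n \<notin> V b" by auto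
    obtain k where k: "k \<in> N c" "(w + n) + k \<notin> V c" using esc[of c "w + n"] by (auto simp: N_def)
    \<comment> \<open>The new step \<open>k\<close> belongs to \<open>M b\<close> for every earlier index \<open>b\<close>, so it cannot lead back into
      \<open>V b\<close>.\<close>
    have "w + (n + k) \<notin> V b" if "b \<in> F" for b
    proof
      assume "w + (n + k) \<in> V b"
      moreover have "- k \<in> M b" using k(1) insert.hyps(2) that M_group by (auto simp: N_def)
      ultimately have "w + (n + k) + - k \<in> V b" by (rule sat)
      then show False using n(2)[OF that] by (simp add: add.assoc[symmetric])
    qed
    moreover have "n + k \<in> N a"
      using n(1) k(1) N_anti[of a c] insert.prems by (intro N_add) auto
    ultimately show ?case using k(2) by (auto simp: add.assoc)
  qed
  have "N a \<inter> (\<Inter>b\<in>{a..}. - {y. w + y \<in> V b}) \<noteq> {}"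
  proof (rule compact_imp_fip_image)
    have "closed (\<Inter>b\<in>{..<a}. M b)" using assms(3) gdelta_subgroup_closed by blast
    then show "compact (N a)" unfolding N_def using assms(2) by (rule compact_Int_closed[rotated])
    show "closed (- {y. w + y \<in> V b})" for b
      using open_left_translate[OF assms(4)] by (simp add: closed_Compl)
    show "N a \<inter> (\<Inter>b\<in>F. - {y. w + y \<in> V b}) \<noteq> {}" if "finite F" "F \<subseteq> {a..}" for F
      using finite_escape[OF that] by auto
  qed
  then obtain n where n: "n \<in> N a" "\<And>b. a \<le> b \<Longrightarrow> w + n \<notin> V b" by auto
  then obtain h where h: "h \<in> H" "w + n - h \<in> T" using a by (auto simp: T'_def)
  have "w + n - h \<notin> V b" if "a \<le> b" for b
  proof
    assume "w + n - h \<in> V b"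
    moreover have "h \<in> M b" using h(1) by (simp add: H_def)
    ultimately have "w + n - h + h \<in> V b" by (rule sat)
    then show False using n(2)[OF that] by simp
  qed
  with h(2) show thesis by (rule that)
qed

lemma locally_dense_separable_imp_metrizable:
  assumes "locally_compact_space (euclidean :: 'a::{topological_group_add, t2_space} topology)"
    and "locally_dense_separable_space (euclidean :: 'a topology)"
  shows "metrizable_space (euclidean :: 'a topology)"
proof (rule ccontr)
  assume nm: "\<not> metrizable_space (euclidean :: 'a topology)"
  have "\<exists>G C :: 'a set. open G \<and> compact C \<and> 0 \<in> G \<and> G \<subseteq> C"
    using assms(1) by (simp add: locally_compact_space_def)
  then obtain G C :: "'a set" where "open G" "compact C" "0 \<in> G" "G \<subseteq> C" by blast
  then have C: "compact C" "0 \<in> interior C" by (auto simp: interior_def)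
  obtain K where "gdelta_subgroup K" "K \<subseteq> G"
    by (rule ex_saturated_nbhd[OF \<open>open G\<close> \<open>0 \<in> G\<close>]) (rule that)
  moreover from this have "compact K"
    using C(1) \<open>G \<subseteq> C\<close> gdelta_subgroup_closed by (metis compact_Int_closed inf.absorb_iff2 order_trans)
  ultimately have K: "gdelta_subgroup K" "compact K" by auto
  obtain V M :: "omega1 \<Rightarrow> 'a set" where
    VM: "\<And>a. gdelta_subgroup (M a)" "\<And>a. open (V a)" "\<And>a. 0 \<in> V a"
    "\<And>a v m. v \<in> V a \<Longrightarrow> m \<in> M a \<Longrightarrow> v + m \<in> V a"
    "\<And>a x. \<exists>n \<in> K \<inter> (\<Inter>b\<in>{..<a}. M b). x + n \<notin> V a"
    by (rule escaping_nbhds[OF nm C K(1)]) (rule that)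
  obtain U :: "'a set" where U: "open U" "0 \<in> U" "dense_separable_space (top_of_set U)"
    using assms(2) by (auto simp: locally_dense_separable_space_def )
  define D where "D = {x \<in> U. \<exists>a. \<forall>b\<ge>a. x \<notin> V b}"
  have dense: "T \<inter> D \<noteq> {}" if "open T" "T \<subseteq> U" "T \<noteq> {}" for T
  proof -
    obtain w where "w \<in> T" using \<open>T \<noteq> {}\<close> by blast
    obtain x a where "x \<in> T" "\<And>b. a \<le> b \<Longrightarrow> x \<notin> V b"
      by (rule dense_eventually_outside[OF K VM(1,2,4,5) \<open>open T\<close> \<open>w \<in> T\<close>])
        (assumption+, rule that)
    then show ?thesis using \<open>T \<subseteq> U\<close> by (auto simp: D_def)
  qed
  have "U \<subseteq> closure D"
    using dense[of "U - closure D"] U(1) closure_subset[of D] by (auto simp: open_Diff)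
  have "D \<subseteq> U" by (auto simp: D_def)
  then have "top_of_set U closure_of D = U"
    using \<open>U \<subseteq> closure D\<close> by (auto simp: closure_of_subtopology Int_absorb1)
  then have "separable_space (top_of_set D)"
    using U(3) \<open>D \<subseteq> U\<close> unfolding dense_separable_space_def
    by (auto simp: subtopology_subtopology Int_absorb1)
  then obtain E where E: "countable E" "E \<subseteq> D" "D \<subseteq> closure E"
    unfolding separable_space_def by (auto simp: closure_of_subtopology Int_absorb1)
  then have "\<forall>e\<in>E. \<exists>a. \<forall>b\<ge>a. e \<notin> V b" by (auto simp: D_def)
  then obtain \<alpha> where \<alpha>: "\<And>e b. e \<in> E \<Longrightarrow> \<alpha> e \<le> b \<Longrightarrow> e \<notin> V b" by metis
  obtain a where a: "\<And>e. e \<in> E \<Longrightarrow> \<alpha> e < a"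
    using countable_bounded_omega1[of "\<alpha> ` E"] E(1) by auto
  have "(V a \<inter> U) \<inter> D \<noteq> {}"
    using VM(2,3) U(1,2) by (intro dense) auto
  then have "V a \<inter> closure E \<noteq> {}" using E(3) by blast
  then have "V a \<inter> E \<noteq> {}" using open_Int_closure_eq_empty[OF VM(2)] by blast
  then obtain e where "e \<in> E" "e \<in> V a" by blast
  then show False using \<alpha>[OF \<open>e \<in> E\<close> less_imp_le[OF a]] by blast
qed

section \<open>Metrizable locally compact spaces\<close>

lemma (in Metric_space) mtotally_bounded_imp_separable:
  assumes "mtotally_bounded S"
  shows "separable_space (subtopology mtopology S)"
proof -
  have SM: "S \<subseteq> M" using assms by (rule mtotally_bounded_imp_subset)
  have "\<forall>n::nat. \<exists>F. finite F \<and> F \<subseteq> S \<and> S \<subseteq> (\<Union>x\<in>F. mball x (inverse (real (Suc n))))"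
    using assms by (simp add: mtotally_bounded_def)
  then obtain F where F: "\<And>n. finite (F n)" "\<And>n. F n \<subseteq> S"
    "\<And>n. S \<subseteq> (\<Union>x\<in>F n. mball x (inverse (real (Suc n))))" by metis
  show ?thesis
    unfolding separable_space_def
  proof (intro exI conjI)
    show "countable (\<Union>n. F n)" using F(1) by (simp add: countable_finite)
    show sub: "(\<Union>n. F n) \<subseteq> topspace (subtopology mtopology S)" using F(2) SM by auto
    have "S \<subseteq> mtopology closure_of (\<Union>n. F n)"
    proof
      fix x assume "x \<in> S"
      have "\<exists>y \<in> (\<Union>n. F n). y \<in> mball x r" if r: "r > 0" for r
      proof -
        obtain n where n: "inverse (real (Suc n)) < r" using reals_Archimedean[OF r] by blast
        obtain y where "y \<in> F n" "x \<in> mball y (inverse (real (Suc n)))" using F(3) \<open>x \<in> S\<close> by blast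
        then show ?thesis using n by (intro bexI[of _ y]) (auto simp: commute)
      qed
      then show "x \<in> mtopology closure_of (\<Union>n. F n)"
        using \<open>x \<in> S\<close> SM unfolding metric_closure_of by blast
    qed
    moreover have "S \<inter> (\<Union>n. F n) = (\<Union>n. F n)" using F(2) by blast
    ultimately have "subtopology mtopology S closure_of (\<Union>n. F n) = S"
      by (simp add: closure_of_subtopology Int_absorb2)
    then show "subtopology mtopology S closure_of (\<Union>n. F n) = topspace (subtopology mtopology S)"
      using SM by (simp add: Int_absorb1)
  qed
qed

lemma metrizable_locally_compact_imp_locally_hereditarily_separable:
  assumes "metrizable_space X" "locally_compact_space X"
  shows "locally_hereditarily_separable_space X"
  unfolding locally_hereditarily_separable_space_def
proof
  fix x assume "x \<in> topspace X"
  obtain M d where "Metric_space M d" and X: "X = Metric_space.mtopology M d"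
    using assms(1) unfolding metrizable_space_def by blast
  then interpret Metric_space M d by simp
  obtain U K where UK: "openin X U" "compactin X K" "x \<in> U" "U \<subseteq> K"
    using assms(2) \<open>x \<in> topspace X\<close> by (meson locally_compact_space_def)
  have "separable_space (subtopology X S)" if "S \<subseteq> U" for S
  proof -
    have "mtotally_bounded K" using UK(2) unfolding X by (rule compactin_imp_mtotally_bounded)
    moreover have "S \<subseteq> K" using that UK(4) by blast
    ultimately have "mtotally_bounded S" by (rule mtotally_bounded_subset)
    then show ?thesis unfolding X by (rule mtotally_bounded_imp_separable)
  qed
  then have "hereditarily_separable_space (subtopology X U)"
    by (simp add: hereditarily_separable_space_def subtopology_subtopology Int_absorb1)
  with UK show "\<exists>U. openin X U \<and> x \<in> U \<and> hereditarily_separable_space (subtopology X U)" by blast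
qed

lemma hereditarily_separable_imp_dense_separable:
  "hereditarily_separable_space X \<Longrightarrow> dense_separable_space X"
  by (simp add: hereditarily_separable_space_def dense_separable_space_def)

lemma locally_hereditarily_separable_imp_locally_dense_separable:
  "locally_hereditarily_separable_space X \<Longrightarrow> locally_dense_separable_space X"
  unfolding locally_hereditarily_separable_space_def locally_dense_separable_space_def
  using hereditarily_separable_imp_dense_separable by metis

section \<open>The equivalence\<close>

theorem theorem2p27:
  assumes "locally_compact_space (euclidean :: 'a::{topological_group_add, t2_space} topology)"
  shows "(locally_dense_separable_space (euclidean :: 'a topology)
            \<longleftrightarrow> locally_hereditarily_separable_space (euclidean :: 'a topology)) \<and>
         (locally_hereditarily_separable_space (euclidean :: 'a topology)
            \<longleftrightarrow> metrizable_space (euclidean :: 'a topology))"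
  using locally_dense_separable_imp_metrizable[OF assms]
    metrizable_locally_compact_imp_locally_hereditarily_separable[OF _ assms]
    locally_hereditarily_separable_imp_locally_dense_separable[of "euclidean :: 'a topology"]
  by blast

end
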